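(* Let $n\ge2$ and $c\in\mathbb{R}^n$ with $0<c_1<\cdots<c_n$. Let $\mathcal{A}:[n-1]\to[n]$ be a map and let $w\in\mathbb{R}^n$ be generic. The following are equivalent. (i) $\mathcal{A}=\widetilde{\mathcal{A}}^{-(w-\alpha c)}$ is the collision pattern for $n$ particles with velocities $-c$ and locations $-(w-\alpha c)$, for some $\alpha\ge0$ (such that $-(w-\alpha c)$ is weakly increasing). (ii) $\mathcal{A}=\mathcal{A}^w$ is the max-slope arborescence of $(\Delta_{n-1},c)$ with respect to the weight $w$.
   Context: $[k]=\{1,\dots,k\}$ and $\Delta_{n-1}=\mathrm{conv}(e_1,\dots,e_n)$. A weight $w\in\mathbb{R}^n$ is generic if for every $i<n$ the maximum of $\frac{w_j-w_i}{c_j-c_i}$ over $j>i$ is attained by a unique $j$. For generic $w$, the max-slope arborescence of $(\Delta_{n-1},c)$ with respect to $w$ is the map $\mathcal{A}^w:[n-1]\to[n]$ with $\mathcal{A}^w(i)=\mathrm{argmax}\{\frac{w_j-w_i}{c_j-c_i}:j>i\}$ (identifying the vertex $e_i$ with $i$). Particles: consider $n$ particles $1,\dots,n$ on the real line; particle $i$ has constant velocity $-c_i$ and location $-w_i$ at time $t=0$, where $-w_1\le-w_2\le\cdots\le-w_n$. When particles collide (are at the same location at the same time $t\ge0$), they merge: the faster particle, which is the one with the larger label $j$, absorbs the other particle $i<j$ and continues with its velocity $-c_j$, while $i$ disappears. For generic $w$ never more than two surviving particles meet at the same place at the same time. The collision pattern $\widetilde{\mathcal{A}}^{-w}:[n-1]\to[n]$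 is defined by $\widetilde{\mathcal{A}}^{-w}(i)=j$ if particle $i$ is absorbed by particle $j$. *)

theory Defs
  imports Complex_Main "HOL-Library.FuncSet"
begin

text \<open>
  Vectors in \<open>\<real>\<^sup>n\<close> are functions \<open>nat \<Rightarrow> real\<close> of which only the values on \<open>{1..n}\<close> are used.
  Maps \<open>[n-1] \<rightarrow> [n]\<close> are elements of \<open>{1..<n} \<rightarrow>\<^sub>E {1..n}\<close>.
\<close>

definition slope :: "(nat \<Rightarrow> real) \<Rightarrow> (nat \<Rightarrow> real) \<Rightarrow> nat \<Rightarrow> nat \<Rightarrow> real" where
  "slope c w i j = (w j - w i) / (c j - c i)"

definition generic :: "nat \<Rightarrow> (nat \<Rightarrow> real) \<Rightarrow> (nat \<Rightarrow> real) \<Rightarrow> bool" where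
  "generic n c w \<longleftrightarrow>
     (\<forall>i\<in>{1..<n}. \<exists>!j. is_arg_max (slope c w i) (\<lambda>j. j \<in> {i<..n}) j)"

definition max_slope_arborescence ::
    "nat \<Rightarrow> (nat \<Rightarrow> real) \<Rightarrow> (nat \<Rightarrow> real) \<Rightarrow> nat \<Rightarrow> nat" where
  "max_slope_arborescence n c w =
     (\<lambda>i\<in>{1..<n}. arg_max (slope c w i) (\<lambda>j. j \<in> {i<..n}))"

text \<open>Particle \<open>i\<close> starts at \<open>x i\<close> and has constant velocity \<open>v i\<close>.\<close>

definition position :: "(nat \<Rightarrow> real) \<Rightarrow> (nat \<Rightarrow> real) \<Rightarrow> nat \<Rightarrow> real \<Rightarrow> real" where
  "position x v i t = x i + t * v i"

text \<open>
  \<open>surviving n x v i t\<close>: particle \<open>i\<close> has not been absorbed at any time \<open>s\<close> with \<open>0 \<le> s < t\<close>.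
  Particles meeting at time \<open>t\<close> itself thus still count as surviving at \<open>t\<close>.
  A particle can only be absorbed by one with a larger label, so the process is
  well-defined by recursion on the label. That \<open>i\<close> itself survives up to the meeting time
  \<open>s\<close> need not be required in the recursion; see \<open>surviving_iff_not_absorbed\<close> below.
\<close>

function surviving :: "nat \<Rightarrow> (nat \<Rightarrow> real) \<Rightarrow> (nat \<Rightarrow> real) \<Rightarrow> nat \<Rightarrow> real \<Rightarrow> bool" where
  "surviving n x v i t \<longleftrightarrow>
     (\<forall>j\<in>{i<..n}. \<forall>s\<in>{0..<t}. surviving n x v j s \<longrightarrow> position x v i s \<noteq> position x v j s)"
  by pat_completeness auto
termination
  by (relation "measure (\<lambda>(n, x, v, i, t). n - i)") auto

declare surviving.simps [simp del]

definition absorbed_at ::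
    "nat \<Rightarrow> (nat \<Rightarrow> real) \<Rightarrow> (nat \<Rightarrow> real) \<Rightarrow> nat \<Rightarrow> nat \<Rightarrow> real \<Rightarrow> bool" where
  "absorbed_at n x v i j t \<longleftrightarrow>
     0 \<le> t \<and> j \<in> {i<..n} \<and> surviving n x v i t \<and> surviving n x v j t \<and>
     position x v i t = position x v j t"

lemma surviving_iff_not_absorbed:
  assumes "inj_on v {1..n}" "i \<in> {1..n}"
  shows "surviving n x v i t \<longleftrightarrow> \<not> (\<exists>s<t. \<exists>j. absorbed_at n x v i j s)"
proof
  assume "surviving n x v i t"
  then show "\<not> (\<exists>s<t. \<exists>j. absorbed_at n x v i j s)"
    by (subst (asm) surviving.simps) (auto simp: absorbed_at_def)
next
  assume not_absorbed: "\<not> (\<exists>s<t. \<exists>j. absorbed_at n x v i j s)"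
  define M where "M = {s \<in> {0..<t}. \<exists>j\<in>{i<..n}. surviving n x v j s \<and>
    position x v i s = position x v j s}"
  have "M \<subseteq> (\<lambda>j. (x j - x i) / (v i - v j)) ` {i<..n}"
  proof
    fix s assume "s \<in> M"
    then obtain j where j: "j \<in> {i<..n}" "position x v i s = position x v j s"
      by (auto simp: M_def)
    have "v i \<noteq> v j"
      using inj_onD[OF assms(1), of i j] assms(2) j(1) by auto
    then have "s = (x j - x i) / (v i - v j)"
      using j(2) by (simp add: position_def field_simps)
    with j(1) show "s \<in> (\<lambda>j. (x j - x i) / (v i - v j)) ` {i<..n}" by blast
  qed
  then have fin: "finite M" by (rule finite_subset) simp
  have "M = {}"
  proof (rule ccontr)
    assume "M \<noteq> {}"
    then have min: "Min M \<in> M" "\<And>s. s \<in> M \<Longrightarrow> Min M \<le> s"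
      using fin by auto
    have "surviving n x v i (Min M)"
      using min by (subst surviving.simps) (force simp: M_def)
    with min(1) not_absorbed show False
      by (auto simp: M_def absorbed_at_def)
  qed
  then show "surviving n x v i t"
    by (subst surviving.simps) (auto simp: M_def)
qed

text \<open>
  The labels are assumed to be ordered by increasing speed. If more than two surviving
  particles met at the same place and time, \<open>absorbed_at\<close> would not be single-valued and no
  map would qualify as collision pattern; genericity rules this out.
\<close>

definition is_collision_pattern ::
    "nat \<Rightarrow> (nat \<Rightarrow> real) \<Rightarrow> (nat \<Rightarrow> real) \<Rightarrow> (nat \<Rightarrow> nat) \<Rightarrow> bool" where
  "is_collision_pattern n x v \<A> \<longleftrightarrow>
     \<A> \<in> {1..<n} \<rightarrow>\<^sub>E {1..n} \<and>
     (\<forall>i\<in>{1..<n}. \<forall>j\<in>{1..n}. \<A> i = j \<longleftrightarrow> (\<exists>t. absorbed_at n x v i j t))"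

end

(* With locations -(w - \<alpha> c) and velocities -c, the trajectories of particles i < j cross
   exactly at time \<alpha> minus the slope from i to j. So the first crossing of i with a larger label
   is with the maximizer m of the slope. No k > m can have absorbed m before that: slope m k > slope i m
   would give slope i k > slope i m. *)

theory Submission
  imports Defs
begin

lemma position_eq_iff_slope:
  assumes "c i < c j"
  shows "position (\<lambda>i. - (w i - \<alpha> * c i)) (\<lambda>i. - c i) i t =
      position (\<lambda>i. - (w i - \<alpha> * c i)) (\<lambda>i. - c i) j t \<longleftrightarrow> t = \<alpha> - slope c w i j"
  using assms by (auto simp: position_def slope_def field_simps)

text \<open>Links ordered starting locations to slopes bounded by \<alpha>. Read from right to left
  it makes the first meeting time nonnegative; read from left to right it shows that a large
  \<alpha> is admissible.\<close>

lemma slope_le_iff: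
  assumes "c i < c j"
  shows "slope c w i j \<le> \<alpha> \<longleftrightarrow> - (w i - \<alpha> * c i) \<le> - (w j - \<alpha> * c j)"
  using assms by (auto simp: slope_def field_simps)

text \<open>\<open>slope c w i k\<close> is the average of \<open>slope c w i j\<close> and
  \<open>slope c w j k\<close> with positive weights \<open>c j - c i\<close> and
  \<open>c k - c j\<close>, so it exceeds the smaller of the two.\<close>

lemma slope_less_trans:
  assumes "c i < c j" "c j < c k" "slope c w i j < slope c w j k"
  shows "slope c w i j < slope c w i k"
proof -
  define s where "s = slope c w i j"
  have "w j - w i = s * (c j - c i)"
    using assms(1) by (simp add: s_def slope_def)
  moreover have "s * (c k - c j) < w k - w j"
    using assms(2,3) by (simp add: s_def[symmetric]) (simp add: slope_def field_simps)
  ultimately have "s * (c k - c i) < w k - w i"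
    by (simp add: algebra_simps)
  then show ?thesis
    using assms(1,2) unfolding s_def[symmetric] by (simp add: slope_def field_simps)
qed

lemma absorbed_at_iff_arg_max_slope:
  fixes c w :: "nat \<Rightarrow> real" and \<alpha> :: real
  defines "x \<equiv> \<lambda>i. - (w i - \<alpha> * c i)" and "v \<equiv> \<lambda>i. - c i"
  assumes c: "strict_mono_on {1..n} c" and x: "mono_on {1..n} x"
    and i: "i \<in> {1..<n}" and m: "m \<in> {i<..n}"
    and max: "\<And>k. k \<in> {i<..n} \<Longrightarrow> k \<noteq> m \<Longrightarrow> slope c w i k < slope c w i m"
  shows "(\<exists>t. absorbed_at n x v i j t) \<longleftrightarrow> j = m"
proof -
  have less: "c a < c b" if "1 \<le> a" "a < b" "b \<le> n" for a b
    using strict_mono_onD[OF c, of a b] that by auto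
  have meet: "position x v a t = position x v b t \<longleftrightarrow> t = \<alpha> - slope c w a b"
    if "1 \<le> a" "a < b" "b \<le> n" for a b t
    unfolding x_def v_def using less[OF that] by (rule position_eq_iff_slope)
  define T where "T = \<alpha> - slope c w i m"
  have "x i \<le> x m"
    using x i m by (auto intro: mono_onD)
  then have T: "0 \<le> T"
    unfolding T_def x_def using slope_le_iff[of c i m w \<alpha>] less[of i m] i m by simp
  \<comment> \<open>By maximality the trajectory of \<open>i\<close> crosses none of a larger label
    before \<open>T\<close>, whether or not that particle still exists then. A meeting at
    \<open>T\<close> itself is compatible with surviving at \<open>T\<close>.\<close>
  have i_survives: "surviving n x v i T"
  proof (subst surviving.simps, intro ballI impI)
    fix k s assume k: "k \<in> {i<..n}" and s: "s \<in> {0..<T}"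
    have "slope c w i k \<le> slope c w i m"
      using max[OF k] by (cases "k = m") auto
    then show "position x v i s \<noteq> position x v k s"
      using s i k meet[of i k s] by (simp add: T_def)
  qed
  have m_survives: "surviving n x v m T"
  proof (subst surviving.simps, intro ballI impI notI)
    fix k s assume k: "k \<in> {m<..n}" and s: "s \<in> {0..<T}"
      and "position x v m s = position x v k s"
    then have "slope c w i m < slope c w m k"
      using i m meet[of m k s] by (simp add: T_def)
    then have "slope c w i m < slope c w i k"
      using i m k by (intro slope_less_trans[of c i m k] less) auto
    then show False
      using max[of k] m k by auto
  qed
  have meet_m: "position x v i T = position x v m T"
    using meet[of i m T] i m by (simp add: T_def)
  show ?thesis
  proof
    assume "j = m"
    then show "\<exists>t. absorbed_at n x v i j t"
      using T m i_survives m_survives meet_m by (auto simp: absorbed_at_def)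
  next
    assume "\<exists>t. absorbed_at n x v i j t"
    then obtain t where j: "j \<in> {i<..n}" and t: "surviving n x v i t"
      and eq: "position x v i t = position x v j t"
      by (auto simp: absorbed_at_def)
    show "j = m"
    proof (rule ccontr)
      assume "j \<noteq> m"
      \<comment> \<open>The crossing with \<open>j\<close> would come strictly after
        \<open>m\<close> has absorbed \<open>i\<close> at time \<open>T\<close>, contradicting that
        \<open>i\<close> survives at \<open>t\<close>.\<close>
      then have "T < t"
        using max[OF j] meet[of i j t] eq i j by (simp add: T_def)
      with t T m m_survives meet_m show False
        by (subst (asm) surviving.simps) auto
    qed
  qed
qed

lemma generic_arg_max_slope:
  assumes "generic n c w" "i \<in> {1..<n}"
  defines "m \<equiv> max_slope_arborescence n c w i"
  shows "m \<in> {i<..n}"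
    and "\<And>k. k \<in> {i<..n} \<Longrightarrow> k \<noteq> m \<Longrightarrow> slope c w i k < slope c w i m"
proof -
  have ex1: "\<exists>!j. is_arg_max (slope c w i) (\<lambda>j. j \<in> {i<..n}) j"
    using assms(1,2) by (simp add: generic_def)
  \<comment> \<open>\<open>arg_max\<close> is a Hilbert choice, so it is a maximizer only because
    one exists.\<close>
  have m: "is_arg_max (slope c w i) (\<lambda>j. j \<in> {i<..n}) m"
    using assms(2) someI_ex[OF ex1_implies_ex[OF ex1]]
    by (simp add: m_def max_slope_arborescence_def arg_max_def)
  then show "m \<in> {i<..n}"
    by (simp add: is_arg_max_def)
  show "slope c w i k < slope c w i m" if "k \<in> {i<..n}" "k \<noteq> m" for k
  proof (rule ccontr)
    assume "\<not> slope c w i k < slope c w i m"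
    \<comment> \<open>Such a \<open>k\<close> would be a second maximizer.\<close>
    then have "is_arg_max (slope c w i) (\<lambda>j. j \<in> {i<..n}) k"
      using m that(1) by (auto simp: is_arg_max_linorder)
    with ex1 m that(2) show False by blast
  qed
qed

text \<open>The right-hand side is free of \<alpha>: changing \<alpha> moves all crossing times by
  the same amount, so every admissible shift yields the same pattern.\<close>

lemma is_collision_pattern_iff_max_slope_arborescence:
  fixes c w :: "nat \<Rightarrow> real"
  assumes "strict_mono_on {1..n} c" "mono_on {1..n} (\<lambda>i. - (w i - \<alpha> * c i))"
    and \<A>: "\<A> \<in> {1..<n} \<rightarrow>\<^sub>E {1..n}" and gen: "generic n c w"
  shows "is_collision_pattern n (\<lambda>i. - (w i - \<alpha> * c i)) (\<lambda>i. - c i) \<A> \<longleftrightarrow>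
    \<A> = max_slope_arborescence n c w" (is "?pattern \<longleftrightarrow> \<A> = ?B")
proof -
  have "?pattern \<longleftrightarrow> (\<forall>i\<in>{1..<n}. \<forall>j\<in>{1..n}. \<A> i = j \<longleftrightarrow> j = ?B i)"
    using \<A> absorbed_at_iff_arg_max_slope[OF assms(1,2) _ generic_arg_max_slope[OF gen]]
    by (simp add: is_collision_pattern_def)
  \<comment> \<open>For the forward direction take \<open>j\<close> to be \<open>\<A> i\<close>,
    which lies in \<open>{1..n}\<close>.\<close>
  also have "\<dots> \<longleftrightarrow> (\<forall>i\<in>{1..<n}. \<A> i = ?B i)"
    using PiE_mem[OF \<A>] by fastforce
  \<comment> \<open>Outside \<open>{1..<n}\<close> both maps take the value
    \<open>undefined\<close>.\<close>
  also have "\<dots> \<longleftrightarrow> \<A> = ?B"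
    using \<A> by (auto simp: max_slope_arborescence_def PiE_def
        intro: extensionalityI[of _ "{1..<n}"])
  finally show ?thesis .
qed

lemma ex_shift_mono_on:
  fixes c w :: "nat \<Rightarrow> real"
  assumes "strict_mono_on {1..n} c"
  shows "\<exists>\<alpha>\<ge>0. mono_on {1..n} (\<lambda>i. - (w i - \<alpha> * c i))"
proof -
  \<comment> \<open>\<alpha> will be the maximum of \<open>S\<close>, an upper bound of all slopes;
    the inserted 0 makes \<open>S\<close> nonempty and its maximum nonnegative.\<close>
  define S where "S = insert 0 ((\<lambda>(i, j). slope c w i j) ` ({1..n} \<times> {1..n}))"
  have "finite S" by (simp add: S_def)
  then have le: "s \<le> Max S" if "s \<in> S" for s
    using that by simp
  have "- (w i - Max S * c i) \<le> - (w j - Max S * c j)"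
    if "i \<in> {1..n}" "j \<in> {1..n}" "i \<le> j" for i j
  proof (cases "i = j")
    case False
    then have "c i < c j"
      using strict_mono_onD[OF assms] that by simp
    moreover have "slope c w i j \<le> Max S"
      using that by (intro le) (auto simp: S_def)
    ultimately show ?thesis
      using slope_le_iff by blast
  qed simp
  moreover have "0 \<le> Max S"
    by (rule le) (simp add: S_def)
  ultimately show ?thesis
    by (blast intro: mono_onI)
qed

theorem theorem4p1:
  fixes n :: nat and c w :: "nat \<Rightarrow> real" and \<A> :: "nat \<Rightarrow> nat"
  assumes "n \<ge> 2"
    and "0 < c 1" and "strict_mono_on {1..n} c"
    and "\<A> \<in> {1..<n} \<rightarrow>\<^sub>E {1..n}"
    and "generic n c w"
  shows "(\<exists>\<alpha>\<ge>0. mono_on {1..n} (\<lambda>i. - (w i - \<alpha> * c i)) \<and>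
            is_collision_pattern n (\<lambda>i. - (w i - \<alpha> * c i)) (\<lambda>i. - c i) \<A>)
         \<longleftrightarrow> \<A> = max_slope_arborescence n c w"
  \<comment> \<open>From left to right the given \<alpha> is used; the converse needs the existence
    of an admissible one.\<close>
  using is_collision_pattern_iff_max_slope_arborescence[OF assms(3) _ assms(4,5)]
    ex_shift_mono_on[OF assms(3)] by blast

end
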